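(* Let $\Gamma$ be the resolution graph (a tree of rational curves, with negative definite lattice $L$) of a good resolution of a complex normal surface singularity with rational homology sphere link, and let $$\mathcal S'_{dom}=\{l'\in L':\chi(l')<\chi(l'+l)\ \text{for all } l\in L_{>0}\}=\{l'\in L':\chi(l)>(l',l)\ \text{for all } l\in L_{>0}\}.$$ Then $\mathcal S'_{dom}$ has the following properties: (i) $\mathcal S'_{dom}\subset\mathcal S'$. (ii) $0\in\mathcal S'_{dom}$ if and only if $L$ (that is, the graph $\Gamma$) is rational. More generally, for $I\subset\mathcal V$ and $n_v>0$ for all $v\in I$, if $\sum_{v\in I}n_vE_v^*\in\mathcal S'_{dom}$ then the components of $\bigcup_{v\notin I}E_v$ are rational. Hence, in general, $\mathcal S'\setminus\mathcal S'_{dom}$ is infinite. (iii) $\mathcal S'\cap(Z_K/2+\mathcal S'_{\mathbb Q})\subset\mathcal S'_{dom}$, where $\mathcal S'_{\mathbb Q}=\{l'\in L\otimes\mathbb Q:(l',E_v)\le0\ \text{for all } v\}$. (iv) $\mathcal S'_{dom}$ is a semigroup (not necessarily with identity element). (v) $\mathcal S'_{dom}$ is an $\mathcal S'$-module, that is, if $l_1'\in\mathcal S'_{dom}$ and $l_2'\in\mathcal S'$ then $l_1'+l_2'\in\mathcal S'_{dom}$. (vi) $\mathcal S'_{dom}$ is min-stable, like $\mathcal S'$, that is, if $l_1',l_2'\in\mathcal S'_{dom}$ then $\min\{l_1',l_2'\}\in\mathcal S'_{dom}$.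
   Context: $L=\bigoplus_{v\in\mathcal V}\mathbb Z E_v$ is the lattice of the exceptional curves $E_v\cong\mathbb P^1$ with its negative definite intersection form $(\,,\,)$ given by the tree $\Gamma$; $L'=\{l'\in L\otimes\mathbb Q:(l',L)\subset\mathbb Z\}$; $E_v^*\in L'$ is defined by $(E_v^*,E_w)=-\delta_{vw}$. $L_{>0}$ is the set of nonzero elements of $L$ with all coefficients $\ge0$. $\mathcal S'=\{l'\in L':(l',E_v)\le0\ \forall v\}$. $Z_K\in L'$ is defined by $(-Z_K+E_v,E_v)+2=0$ for all $v$, and $\chi(l')=-(l',l'-Z_K)/2$. A lattice/graph (or the connected curve it represents) is rational if $\chi(l)\ge1$ for every nonzero effective integral cycle $l$ supported on it (Artin's criterion). The minimum of two elements is the coefficientwise minimum in the basis $\{E_v\}$.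
   Formalization: In (vi), min-stability is stated for l_1', l_2' in the same class of L'/L (l_1'-l_2' in L); for arbitrary pairs it fails, e.g. for A_2 the minimum of E_1^* and E_2^* is not in L'. *)

theory Defs
  imports Complex_Main "HOL-Library.Function_Algebras"
begin

text \<open>
  A resolution graph with rational exceptional curves: the vertices index the curves
  \<open>E\<^sub>v\<close>, the edges (a symmetric relation) record their intersection points, and
  \<open>selfint v\<close> is the self-intersection number of \<open>E\<^sub>v\<close>.
\<close>

record 'v res_graph =
  verts :: "'v set"
  edges :: "'v rel"
  selfint :: "'v \<Rightarrow> int"

definition is_cycle :: "'v rel \<Rightarrow> 'v list \<Rightarrow> bool" where
  "is_cycle E p \<longleftrightarrow>
     length p \<ge> 3 \<and> distinct p \<and>
     (\<forall>i. Suc i < length p \<longrightarrow> (p ! i, p ! Suc i) \<in> E) \<and> (last p, hd p) \<in> E"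

definition is_tree :: "'v set \<Rightarrow> 'v rel \<Rightarrow> bool" where
  "is_tree V E \<longleftrightarrow>
     finite V \<and> V \<noteq> {} \<and> E \<subseteq> V \<times> V \<and> sym E \<and> irrefl E \<and>
     (\<forall>u\<in>V. \<forall>v\<in>V. (u, v) \<in> E\<^sup>*) \<and> (\<nexists>p. is_cycle E p)"

text \<open>The vertex sets of the connected components of the subgraph induced on \<open>W\<close>.\<close>

definition graph_components :: "'v res_graph \<Rightarrow> 'v set \<Rightarrow> 'v set set" where
  "graph_components \<Gamma> W = {{v. (u, v) \<in> (edges \<Gamma> \<inter> W \<times> W)\<^sup>*} | u. u \<in> W}"

text \<open>
  Rational cycles are functions vanishing off the vertex set, the value at \<open>v\<close> being
  the coefficient of \<open>E\<^sub>v\<close>.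
\<close>

definition LQ :: "'v res_graph \<Rightarrow> ('v \<Rightarrow> rat) set" where
  "LQ \<Gamma> = {x. \<forall>v. v \<notin> verts \<Gamma> \<longrightarrow> x v = 0}"

definition L :: "'v res_graph \<Rightarrow> ('v \<Rightarrow> rat) set" where
  "L \<Gamma> = {x \<in> LQ \<Gamma>. \<forall>v. x v \<in> \<int>}"

definition curve :: "'v \<Rightarrow> 'v \<Rightarrow> rat" where
  "curve v = (\<lambda>w. if w = v then 1 else 0)"

definition scale :: "rat \<Rightarrow> ('v \<Rightarrow> rat) \<Rightarrow> 'v \<Rightarrow> rat" where
  "scale q x = (\<lambda>v. q * x v)"

definition curve_int :: "'v res_graph \<Rightarrow> 'v \<Rightarrow> 'v \<Rightarrow> int" where
  "curve_int \<Gamma> v w =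
     (if v = w then selfint \<Gamma> v else if (v, w) \<in> edges \<Gamma> then 1 else 0)"

definition int_form :: "'v res_graph \<Rightarrow> ('v \<Rightarrow> rat) \<Rightarrow> ('v \<Rightarrow> rat) \<Rightarrow> rat" where
  "int_form \<Gamma> x y =
     (\<Sum>v\<in>verts \<Gamma>. \<Sum>w\<in>verts \<Gamma>. x v * y w * of_int (curve_int \<Gamma> v w))"

text \<open>
  By Grauert's theorem the following graphs are exactly the resolution graphs of good
  resolutions of normal surface singularities with rational homology sphere link.
\<close>

definition resolution_graph :: "'v res_graph \<Rightarrow> bool" where
  "resolution_graph \<Gamma> \<longleftrightarrow>
     is_tree (verts \<Gamma>) (edges \<Gamma>) \<and>
     (\<forall>x\<in>L \<Gamma>. x \<noteq> 0 \<longrightarrow> int_form \<Gamma> x x < 0)"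

definition L_dual :: "'v res_graph \<Rightarrow> ('v \<Rightarrow> rat) set" where
  "L_dual \<Gamma> = {x \<in> LQ \<Gamma>. \<forall>l\<in>L \<Gamma>. int_form \<Gamma> x l \<in> \<int>}"

definition L_pos :: "'v res_graph \<Rightarrow> ('v \<Rightarrow> rat) set" where
  "L_pos \<Gamma> = {l \<in> L \<Gamma>. l \<noteq> 0 \<and> (\<forall>v. l v \<ge> 0)}"

definition curve_dual :: "'v res_graph \<Rightarrow> 'v \<Rightarrow> 'v \<Rightarrow> rat" where
  "curve_dual \<Gamma> v =
     (THE x. x \<in> L_dual \<Gamma> \<and>
        (\<forall>w\<in>verts \<Gamma>. int_form \<Gamma> x (curve w) = - (if v = w then 1 else 0)))"

definition Z_K :: "'v res_graph \<Rightarrow> 'v \<Rightarrow> rat" where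
  "Z_K \<Gamma> =
     (THE z. z \<in> L_dual \<Gamma> \<and>
        (\<forall>v\<in>verts \<Gamma>. int_form \<Gamma> (- z + curve v) (curve v) + 2 = 0))"

definition chi :: "'v res_graph \<Rightarrow> ('v \<Rightarrow> rat) \<Rightarrow> rat" where
  "chi \<Gamma> x = - int_form \<Gamma> x (x - Z_K \<Gamma>) / 2"

text \<open>Artin's criterion, for the curve with components \<open>E\<^sub>v\<close>, \<open>v \<in> C\<close>.\<close>

definition rational_on :: "'v res_graph \<Rightarrow> 'v set \<Rightarrow> bool" where
  "rational_on \<Gamma> C \<longleftrightarrow> (\<forall>l\<in>L_pos \<Gamma>. {v. l v \<noteq> 0} \<subseteq> C \<longrightarrow> chi \<Gamma> l \<ge> 1)"

abbreviation rational_graph :: "'v res_graph \<Rightarrow> bool" where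
  "rational_graph \<Gamma> \<equiv> rational_on \<Gamma> (verts \<Gamma>)"

definition S_Q :: "'v res_graph \<Rightarrow> ('v \<Rightarrow> rat) set" where
  "S_Q \<Gamma> = {x \<in> LQ \<Gamma>. \<forall>v\<in>verts \<Gamma>. int_form \<Gamma> x (curve v) \<le> 0}"

definition S' :: "'v res_graph \<Rightarrow> ('v \<Rightarrow> rat) set" where
  "S' \<Gamma> = {x \<in> L_dual \<Gamma>. \<forall>v\<in>verts \<Gamma>. int_form \<Gamma> x (curve v) \<le> 0}"

definition S_dom :: "'v res_graph \<Rightarrow> ('v \<Rightarrow> rat) set" where
  "S_dom \<Gamma> = {x \<in> L_dual \<Gamma>. \<forall>l\<in>L_pos \<Gamma>. chi \<Gamma> x < chi \<Gamma> (x + l)}"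

text \<open>
  Minima are taken within a class of \<open>L'/L\<close>. Across different classes the coefficientwise
  minimum need not lie in \<open>L'\<close>: for the graph \<open>A\<^sub>2\<close> the minimum of
  \<open>E\<^sub>1\<^sup>* = (2/3, 1/3)\<close> and \<open>E\<^sub>2\<^sup>* = (1/3, 2/3)\<close> is \<open>(1/3, 1/3)\<close>, which has
  intersection number \<open>-1/3\<close> with each curve.
\<close>

definition min_stable :: "'v res_graph \<Rightarrow> ('v \<Rightarrow> rat) set \<Rightarrow> bool" where
  "min_stable \<Gamma> A \<longleftrightarrow>
     (\<forall>x\<in>A. \<forall>y\<in>A. x - y \<in> L \<Gamma> \<longrightarrow> (\<lambda>v. min (x v) (y v)) \<in> A)"

end

theory Submission
  imports Defs
begin

text \<open>
  Since \<open>\<chi>(x + l) = \<chi>(x) + \<chi>(l) - (x, l)\<close>, dominance of \<open>x\<close> says \<open>(x, l) < \<chi>(l)\<close> for all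
  \<open>l > 0\<close>, and on \<open>L\<close> the function \<open>\<chi>\<close> takes integer values with \<open>\<chi>(E\<^sub>v) = 1\<close>; this gives
  (i)--(v). A multiple of \<open>E\<^sub>u\<^sup>*\<close> is orthogonal to every cycle avoiding \<open>E\<^sub>u\<close>, so a single cycle
  \<open>l > 0\<close> avoiding \<open>E\<^sub>u\<close> with \<open>\<chi>(l) \<le> 0\<close> keeps all these multiples out of \<open>S_dom\<close>.
  For (vi), \<open>\<chi>\<close> is submodular because effective cycles without common component have nonnegative
  intersection; comparing \<open>min x y + l\<close> first with \<open>x\<close> and then with \<open>y\<close> lowers \<open>\<chi>\<close> down to
  \<open>\<chi>(min x y)\<close>.
\<close>

section \<open>Bilinearity of the form and closure properties of \<open>LQ\<close> and
  \<open>L\<close>\<close>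

lemma int_form_add_left: "int_form \<Gamma> (x + y) z = int_form \<Gamma> x z + int_form \<Gamma> y z"
  by (simp add: int_form_def algebra_simps sum.distrib)

lemma int_form_add_right: "int_form \<Gamma> z (x + y) = int_form \<Gamma> z x + int_form \<Gamma> z y"
  by (simp add: int_form_def algebra_simps sum.distrib)

lemma int_form_scale_left: "int_form \<Gamma> (scale q x) z = q * int_form \<Gamma> x z"
  by (simp add: int_form_def scale_def sum_distrib_left mult.assoc)

lemma int_form_scale_right: "int_form \<Gamma> z (scale q x) = q * int_form \<Gamma> z x"
  by (simp add: int_form_def scale_def sum_distrib_left mult_ac)

lemma int_form_minus_left: "int_form \<Gamma> (- x) z = - int_form \<Gamma> x z"
  by (simp add: int_form_def sum_negf)

lemma int_form_minus_right: "int_form \<Gamma> z (- x) = - int_form \<Gamma> z x"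
  by (simp add: int_form_def sum_negf)

lemma int_form_diff_left: "int_form \<Gamma> (x - y) z = int_form \<Gamma> x z - int_form \<Gamma> y z"
  using int_form_add_left[of \<Gamma> x "- y" z] by (simp add: int_form_minus_left)

lemma int_form_diff_right: "int_form \<Gamma> z (x - y) = int_form \<Gamma> z x - int_form \<Gamma> z y"
  using int_form_add_right[of \<Gamma> z x "- y"] by (simp add: int_form_minus_right)

lemma int_form_zero_left: "int_form \<Gamma> 0 z = 0"
  by (simp add: int_form_def)

lemma int_form_sum_left:
  "finite A \<Longrightarrow> int_form \<Gamma> (\<Sum>a\<in>A. f a) z = (\<Sum>a\<in>A. int_form \<Gamma> (f a) z)"
proof (induction A rule: finite_induct)
  case (insert a A)
  then show ?case
    by (subst (1 2) sum.insert) (auto simp only: int_form_add_left)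
qed (simp only: sum.empty int_form_zero_left)

lemmas int_form_linear =
  int_form_add_left int_form_add_right int_form_diff_left int_form_diff_right
  int_form_minus_left int_form_minus_right int_form_scale_left int_form_scale_right

lemma LQ_add: "x \<in> LQ \<Gamma> \<Longrightarrow> y \<in> LQ \<Gamma> \<Longrightarrow> x + y \<in> LQ \<Gamma>"
  by (simp add: LQ_def)

lemma LQ_diff: "x \<in> LQ \<Gamma> \<Longrightarrow> y \<in> LQ \<Gamma> \<Longrightarrow> x - y \<in> LQ \<Gamma>"
  by (simp add: LQ_def)

lemma LQ_scale: "x \<in> LQ \<Gamma> \<Longrightarrow> scale q x \<in> LQ \<Gamma>"
  by (simp add: LQ_def scale_def)

lemma L_diff: "x \<in> L \<Gamma> \<Longrightarrow> y \<in> L \<Gamma> \<Longrightarrow> x - y \<in> L \<Gamma>"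
  by (simp add: L_def LQ_diff)

lemma L_minus: "x \<in> L \<Gamma> \<Longrightarrow> - x \<in> L \<Gamma>"
  by (simp add: L_def LQ_def)

lemma curve_in_L: "v \<in> verts \<Gamma> \<Longrightarrow> curve v \<in> L \<Gamma>"
  by (auto simp: L_def LQ_def curve_def)

lemma curve_in_L_pos: "v \<in> verts \<Gamma> \<Longrightarrow> curve v \<in> L_pos \<Gamma>"
  by (auto simp: L_pos_def curve_in_L) (auto simp: curve_def dest: fun_cong[of _ _ v])

text \<open>The difference is the positive part of \<open>x - y\<close>, so its coefficients are
  integers as well.\<close>

lemma min_in_L:
  assumes "x - y \<in> L \<Gamma>"
  shows "x - (\<lambda>v. min (x v) (y v)) \<in> L \<Gamma>"
proof -
  have "x - (\<lambda>v. min (x v) (y v)) = (\<lambda>v. max 0 ((x - y) v))"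
    by (auto simp: fun_eq_iff min_def max_def)
  then show ?thesis
    using assms by (auto simp: L_def LQ_def max_def)
qed

lemma common_denominator:
  fixes x :: "'a \<Rightarrow> rat"
  assumes "finite W"
  shows "\<exists>N::int. N > 0 \<and> (\<forall>v\<in>W. of_int N * x v \<in> \<int>)"
  using assms
proof (induction W)
  case empty
  show ?case by (auto intro: exI[of _ 1])
next
  case (insert u W)
  then obtain N :: int where N: "N > 0" "\<And>v. v \<in> W \<Longrightarrow> of_int N * x v \<in> \<int>"
    by auto
  obtain a b where ab: "quotient_of (x u) = (a, b)"
    by force
  then have b: "b > 0" and xu: "x u = of_int a / of_int b"
    by (auto simp: quotient_of_denom_pos quotient_of_div)
  have "of_int (N * b) * x v \<in> \<int>" if "v \<in> insert u W" for v
  proof (cases "v = u")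
    case True
    have "of_int (N * b) * x v = of_int (N * a)"
      using b by (simp add: True xu)
    then show ?thesis by (metis Ints_of_int)
  next
    case False
    then have "of_int b * (of_int N * x v) \<in> \<int>"
      using that by (intro Ints_mult[OF _ N(2)]) auto
    then show ?thesis by (simp add: mult_ac)
  qed
  with N(1) b show ?case
    by (intro exI[of _ "N * b"]) auto
qed

lemma graph_components_subset: "C \<in> graph_components \<Gamma> W \<Longrightarrow> C \<subseteq> W"
  by (auto simp: graph_components_def elim: rtranclE)

section \<open>Nondegeneracy of the form, the dual lattice and the dual elements\<close>

locale resolution =
  fixes \<Gamma> :: "'v res_graph"
  assumes resolution: "resolution_graph \<Gamma>"
begin

abbreviation V where "V \<equiv> verts \<Gamma>"

abbreviation pairing (infixl "\<bullet>" 70) where "x \<bullet> y \<equiv> int_form \<Gamma> x y"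

lemma finite_V: "finite V"
  using resolution by (simp add: resolution_graph_def is_tree_def)

lemma curve_int_sym: "curve_int \<Gamma> v w = curve_int \<Gamma> w v"
  using resolution by (auto simp: resolution_graph_def is_tree_def curve_int_def dest: symD)

lemma int_form_sym: "x \<bullet> y = y \<bullet> x"
  unfolding int_form_def
  by (subst sum.swap) (simp add: curve_int_sym mult_ac)

lemma int_form_curve_left: "v \<in> V \<Longrightarrow> curve v \<bullet> x = (\<Sum>w\<in>V. x w * of_int (curve_int \<Gamma> v w))"
  by (simp add: int_form_def curve_def mult.assoc finite_V if_distrib[of "\<lambda>c. c * _"] sum.delta
      flip: sum_distrib_left cong: if_cong)
    (subst sum.swap, simp add: finite_V sum.delta)

lemma int_form_curve_curve:
  "v \<in> V \<Longrightarrow> w \<in> V \<Longrightarrow> curve v \<bullet> curve w = of_int (curve_int \<Gamma> v w)"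
  by (simp add: int_form_curve_left)
    (simp add: curve_def finite_V if_distrib[of "\<lambda>c. c * _"] sum.delta cong: if_cong)

text \<open>Bounds, integrality and vanishing of a pairing can all be read off from the numbers
  \<open>x \<bullet> curve v\<close> through this expansion.\<close>

lemma int_form_expand: "x \<bullet> y = (\<Sum>v\<in>V. y v * (x \<bullet> curve v))"
proof -
  have "y \<bullet> x = (\<Sum>v\<in>V. y v * (curve v \<bullet> x))"
    unfolding int_form_def[of _ y x]
    by (intro sum.cong) (auto simp: int_form_curve_left sum_distrib_left mult_ac)
  then show ?thesis by (simp add: int_form_sym)
qed

text \<open>Definiteness is given on \<open>L\<close> only. Clearing denominators by
  \<open>N\<close> multiplies the square by \<open>N * N > 0\<close>, so the sign carries over to
  rational cycles.\<close>

lemma negative_definite: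
  assumes "x \<in> LQ \<Gamma>" "x \<noteq> 0"
  shows "x \<bullet> x < 0"
proof -
  obtain N :: int where N: "N > 0" "\<And>v. v \<in> V \<Longrightarrow> of_int N * x v \<in> \<int>"
    using common_denominator[OF finite_V] by metis
  let ?y = "scale (of_int N) x"
  have "of_int N * x v \<in> \<int>" for v
    using N(2) assms(1) by (cases "v \<in> V") (auto simp: LQ_def)
  then have "?y \<in> L \<Gamma>"
    using LQ_scale[OF assms(1)] by (simp add: L_def) (simp add: scale_def)
  moreover have "?y \<noteq> 0"
    using assms(2) N(1) by (auto simp: scale_def fun_eq_iff)
  ultimately have "?y \<bullet> ?y < 0"
    using resolution by (simp add: resolution_graph_def)
  then show ?thesis
    using N(1) by (simp add: int_form_linear mult_less_0_iff)
qed

text \<open>Otherwise \<open>x - y\<close> is a nonzero cycle orthogonal to every curve, hence to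
  itself, against definiteness.\<close>

lemma int_form_eqI:
  assumes "x \<in> LQ \<Gamma>" "y \<in> LQ \<Gamma>" "\<And>v. v \<in> V \<Longrightarrow> x \<bullet> curve v = y \<bullet> curve v"
  shows "x = y"
proof (rule ccontr)
  assume "x \<noteq> y"
  then have "(x - y) \<bullet> (x - y) < 0"
    by (intro negative_definite LQ_diff assms) simp
  moreover have "(x - y) \<bullet> (x - y) = 0"
    by (subst int_form_expand) (simp add: int_form_linear assms(3))
  ultimately show False by simp
qed

text \<open>Gaussian elimination: the pivot at a new vertex \<open>u\<close> is the self-intersection of a cycle \<open>z\<close>
  orthogonal to the previous vertices, hence nonzero by definiteness.\<close>

lemma solvable_on:
  assumes "W \<subseteq> V"
  shows "\<exists>x. (\<forall>v. v \<notin> W \<longrightarrow> x v = 0) \<and> (\<forall>w\<in>W. x \<bullet> curve w = r w)"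
proof -
  have "finite W" using assms finite_V by (rule finite_subset)
  then show ?thesis
    using assms
  proof (induction W arbitrary: r)
    case empty
    show ?case by (auto intro: exI[of _ 0])
  next
    case (insert u W)
    obtain y where y: "\<And>v. v \<notin> W \<Longrightarrow> y v = 0" "\<And>w. w \<in> W \<Longrightarrow> y \<bullet> curve w = - (curve u \<bullet> curve w)"
      using insert.IH[of "\<lambda>w. - (curve u \<bullet> curve w)"] insert.prems by auto
    obtain x where x: "\<And>v. v \<notin> W \<Longrightarrow> x v = 0" "\<And>w. w \<in> W \<Longrightarrow> x \<bullet> curve w = r w"
      using insert.IH[of r] insert.prems by auto
    define z where "z = curve u + y"
    define d where "d = z \<bullet> curve u"
    have zW: "z \<bullet> curve w = 0" if "w \<in> W" for w
      using y(2)[OF that] by (simp add: z_def int_form_linear)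
    have zu: "z u = 1"
      using y(1)[of u] insert.hyps by (simp add: z_def curve_def)
    have z0: "z v = 0" if "v \<notin> insert u W" for v
      using y(1)[of v] that by (simp add: z_def curve_def)
    have "z \<bullet> z = (\<Sum>v\<in>insert u W. z v * (z \<bullet> curve v))"
      by (subst int_form_expand, intro sum.mono_neutral_right)
        (use finite_V insert.prems z0 in auto)
    also have "\<dots> = d"
      using insert.hyps by (simp add: zW zu d_def)
    finally have "z \<bullet> z = d" .
    moreover have "z \<in> LQ \<Gamma>"
      using insert.prems by (auto simp: LQ_def intro!: z0)
    moreover have "z \<noteq> 0"
      using zu by auto
    ultimately have d: "d \<noteq> 0"
      using negative_definite[of z] by auto
    \<comment> \<open>Since \<open>z\<close> is orthogonal to the curves in \<open>W\<close>, adding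
      a multiple of it changes only the equation at \<open>u\<close>; this multiple corrects that
      one.\<close>
    define c where "c = (r u - x \<bullet> curve u) / d"
    have "(x + scale c z) v = 0" if "v \<notin> insert u W" for v
      using x(1)[of v] z0[of v] that by (simp add: scale_def)
    moreover have "(x + scale c z) \<bullet> curve w = r w" if "w \<in> insert u W" for w
      using that x(2)[of w] zW[of w] d
      by (auto simp: int_form_linear c_def simp flip: d_def)
    ultimately show ?case by blast
  qed
qed

lemma L_dual_iff: "x \<in> L_dual \<Gamma> \<longleftrightarrow> x \<in> LQ \<Gamma> \<and> (\<forall>v\<in>V. x \<bullet> curve v \<in> \<int>)"
proof -
  have "x \<bullet> l \<in> \<int>" if "\<forall>v\<in>V. x \<bullet> curve v \<in> \<int>" "l \<in> L \<Gamma>" for l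
    using that by (subst int_form_expand) (auto simp: L_def intro!: Ints_mult Ints_sum)
  then show ?thesis
    by (auto simp: L_dual_def curve_in_L)
qed

text \<open>This justifies both definite descriptions, \<open>curve_dual\<close> and
  \<open>Z_K\<close>: each prescribes integral intersection numbers with the curves.\<close>

lemma L_dual_ex1:
  assumes "\<And>v. v \<in> V \<Longrightarrow> r v \<in> \<int>"
  shows "\<exists>!x. x \<in> L_dual \<Gamma> \<and> (\<forall>v\<in>V. x \<bullet> curve v = r v)"
proof (rule ex_ex1I)
  show "\<exists>x. x \<in> L_dual \<Gamma> \<and> (\<forall>v\<in>V. x \<bullet> curve v = r v)"
    using solvable_on[of V r] assms by (auto simp: L_dual_iff LQ_def)
qed (auto simp: L_dual_iff intro: int_form_eqI)

lemma
  assumes "v \<in> V"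
  shows curve_dual_in: "curve_dual \<Gamma> v \<in> L_dual \<Gamma>"
    and curve_dual_curve: "w \<in> V \<Longrightarrow> curve_dual \<Gamma> v \<bullet> curve w = - (if v = w then 1 else 0)"
  using theI'[OF L_dual_ex1[of "\<lambda>w. - (if v = w then 1 else 0)"]]
  by (auto simp: curve_dual_def)

lemma Z_K_curve:
  assumes "v \<in> V"
  shows "Z_K \<Gamma> \<bullet> curve v = of_int (selfint \<Gamma> v) + 2"
proof -
  have *: "(- z + curve v) \<bullet> curve v + 2 = 0 \<longleftrightarrow> z \<bullet> curve v = of_int (selfint \<Gamma> v) + 2"
    if "v \<in> V" for v z
    using that by (auto simp: int_form_linear int_form_curve_curve curve_int_def)
  \<comment> \<open>Adjunction, rewritten as a prescription of intersection numbers, so that unique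
    solvability applies.\<close>
  have eq: "Z_K \<Gamma> = (THE z. z \<in> L_dual \<Gamma> \<and> (\<forall>v\<in>V. z \<bullet> curve v = of_int (selfint \<Gamma> v) + 2))"
    unfolding Z_K_def by (intro arg_cong[where f = The] ext conj_cong ball_cong refl *)
  have "Z_K \<Gamma> \<in> L_dual \<Gamma> \<and> (\<forall>v\<in>V. Z_K \<Gamma> \<bullet> curve v = of_int (selfint \<Gamma> v) + 2)"
    unfolding eq by (rule theI'[OF L_dual_ex1]) auto
  with assms show ?thesis by auto
qed

lemma curve_dual_int_form: "v \<in> V \<Longrightarrow> curve_dual \<Gamma> v \<bullet> l = - l v"
  by (subst int_form_expand)
    (simp add: curve_dual_curve finite_V sum.delta if_distrib cong: if_cong)

section \<open>The function \<chi> and its integrality on \<open>L\<close>\<close>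

lemma chi_add: "chi \<Gamma> (x + y) = chi \<Gamma> x + chi \<Gamma> y - x \<bullet> y"
  by (simp add: chi_def int_form_linear int_form_sym[of y x] field_simps)

text \<open>Adjunction eliminates \<open>Z_K\<close>, which makes \<chi> computable on a concrete
  graph.\<close>

lemma chi_eq: "chi \<Gamma> l = ((\<Sum>v\<in>V. l v * (of_int (selfint \<Gamma> v) + 2)) - l \<bullet> l) / 2"
proof -
  have "Z_K \<Gamma> \<bullet> l = (\<Sum>v\<in>V. l v * (of_int (selfint \<Gamma> v) + 2))"
    by (subst int_form_expand) (simp add: Z_K_curve)
  then show ?thesis
    by (simp add: chi_def int_form_linear int_form_sym[of l "Z_K \<Gamma>"])
qed

lemma chi_scale_curve:
  assumes "v \<in> V"
  shows "chi \<Gamma> (scale q (curve v)) = q - of_int (selfint \<Gamma> v) * (q * (q - 1) / 2)"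
  using assms
  by (simp add: chi_def int_form_linear int_form_curve_curve curve_int_def
      int_form_sym[of _ "Z_K \<Gamma>"] Z_K_curve field_simps)

lemma chi_curve: "v \<in> V \<Longrightarrow> chi \<Gamma> (curve v) = 1"
  using chi_scale_curve[of v 1] by (simp add: scale_def)

text \<open>The cycle is built up one curve at a time. A multiple of a single curve has integral
  \<chi> because \<open>k * (k - 1)\<close> is even, and the mixed term is an intersection number of
  integral cycles.\<close>

lemma chi_Ints:
  assumes "l \<in> L \<Gamma>"
  shows "chi \<Gamma> l \<in> \<int>"
proof -
  have "chi \<Gamma> (\<lambda>v. if v \<in> W then l v else 0) \<in> \<int>" if "W \<subseteq> V" for W
    using finite_subset[OF that finite_V] that
  proof (induction W)
    case empty
    show ?case by (simp add: chi_def int_form_def)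
  next
    case (insert u W)
    let ?l = "\<lambda>v. if v \<in> W then l v else 0"
    obtain k where k: "l u = of_int k"
      using assms by (auto simp: L_def elim: Ints_cases)
    have "even (k * (k - 1))" by auto
    then obtain m where m: "k * (k - 1) = 2 * m" by (rule evenE)
    have "(of_int k :: rat) * (of_int k - 1) = 2 * of_int m"
      using arg_cong[OF m, of "of_int :: int \<Rightarrow> rat"] by simp
    then have 1: "chi \<Gamma> (scale (l u) (curve u)) \<in> \<int>"
      using insert.prems by (simp add: chi_scale_curve k)
    have "?l \<in> L \<Gamma>"
      using assms insert.prems by (auto simp: L_def LQ_def)
    then have "curve u \<bullet> ?l \<in> \<int>"
      using insert.prems assms
      by (auto simp: int_form_curve_left L_def intro!: Ints_mult Ints_sum)
    then have 2: "scale (l u) (curve u) \<bullet> ?l \<in> \<int>"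
      by (simp add: int_form_linear k)
    have "(\<lambda>v. if v \<in> insert u W then l v else 0) = scale (l u) (curve u) + ?l"
      using insert.hyps by (auto simp: scale_def curve_def)
    with 1 2 insert show ?case
      by (auto simp: chi_add)
  qed
  moreover have "(\<lambda>v. if v \<in> V then l v else 0) = l"
    using assms by (auto simp: L_def LQ_def)
  ultimately show ?thesis by (metis order_refl)
qed

text \<open>Integrality turns Artin's bound into mere positivity, the form in which dominance
  delivers it.\<close>

lemma chi_ge_1_iff:
  assumes "l \<in> L \<Gamma>"
  shows "chi \<Gamma> l \<ge> 1 \<longleftrightarrow> chi \<Gamma> l > 0"
proof -
  obtain k where "chi \<Gamma> l = of_int k"
    using chi_Ints[OF assms] by (auto elim: Ints_cases)
  then show ?thesis by (simp add: int_one_le_iff_zero_less)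
qed

section \<open>Dominance: relation to \<open>S'\<close>, rationality and the module
  structure\<close>

lemma S_dom_iff: "x \<in> S_dom \<Gamma> \<longleftrightarrow> x \<in> L_dual \<Gamma> \<and> (\<forall>l\<in>L_pos \<Gamma>. x \<bullet> l < chi \<Gamma> l)"
  by (simp add: S_dom_def chi_add)

text \<open>Testing dominance on \<open>curve v\<close>, where \<chi> is 1, bounds an integer
  strictly below 1.\<close>

lemma S_dom_subset: "S_dom \<Gamma> \<subseteq> S' \<Gamma>"
proof
  fix x assume x: "x \<in> S_dom \<Gamma>"
  then have dual: "x \<in> L_dual \<Gamma>" by (simp add: S_dom_iff)
  have "x \<bullet> curve v \<le> 0" if v: "v \<in> V" for v
  proof -
    have "x \<bullet> curve v < 1"
      using x v chi_curve curve_in_L_pos by (fastforce simp: S_dom_iff)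
    moreover have "x \<bullet> curve v \<in> \<int>"
      using dual v by (simp add: L_dual_iff)
    ultimately show ?thesis by (auto elim!: Ints_cases)
  qed
  with dual show "x \<in> S' \<Gamma>" by (simp add: S'_def)
qed

lemma int_form_nonpos:
  assumes "\<forall>v\<in>V. x \<bullet> curve v \<le> 0" "l \<in> L_pos \<Gamma>"
  shows "x \<bullet> l \<le> 0"
  using assms
  by (subst int_form_expand) (auto simp: L_pos_def intro!: sum_nonpos mult_nonneg_nonpos)

lemma L_dual_add: "x \<in> L_dual \<Gamma> \<Longrightarrow> y \<in> L_dual \<Gamma> \<Longrightarrow> x + y \<in> L_dual \<Gamma>"
  by (simp add: L_dual_def LQ_add int_form_linear)

lemma L_dual_diff: "x \<in> L_dual \<Gamma> \<Longrightarrow> y \<in> L_dual \<Gamma> \<Longrightarrow> x - y \<in> L_dual \<Gamma>"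
  by (simp add: L_dual_def LQ_diff int_form_linear)

text \<open>Adding \<open>y\<close> can only lower the pairing with an effective cycle, so the
  strict bound survives.\<close>

lemma S_dom_add:
  assumes "x \<in> S_dom \<Gamma>" "y \<in> S' \<Gamma>"
  shows "x + y \<in> S_dom \<Gamma>"
proof -
  have "(x + y) \<bullet> l < chi \<Gamma> l" if "l \<in> L_pos \<Gamma>" for l
  proof -
    have "x \<bullet> l < chi \<Gamma> l" "y \<bullet> l \<le> 0"
      using assms that int_form_nonpos[of y l] by (auto simp: S_dom_iff S'_def)
    then show ?thesis by (simp add: int_form_linear)
  qed
  then show ?thesis
    using assms by (auto simp: S_dom_iff S'_def intro: L_dual_add)
qed

lemma zero_in_S_dom_iff: "0 \<in> S_dom \<Gamma> \<longleftrightarrow> rational_graph \<Gamma>"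
proof -
  have "0 \<in> L_dual \<Gamma>"
    by (simp add: L_dual_def LQ_def int_form_zero_left)
  moreover have "{v. l v \<noteq> 0} \<subseteq> V" if "l \<in> L_pos \<Gamma>" for l
    using that by (auto simp: L_pos_def L_def LQ_def)
  ultimately show ?thesis
    by (auto simp: S_dom_iff rational_on_def int_form_zero_left L_pos_def chi_ge_1_iff)
qed

text \<open>A cycle supported on \<open>C\<close> has zero coefficients along \<open>I\<close>, so
  the given sum pairs to 0 with it, and dominance leaves \<open>0 < chi \<Gamma> l\<close>.\<close>

lemma rational_on_if_dominant:
  assumes "I \<subseteq> V" "(\<Sum>v\<in>I. scale (of_int (n v)) (curve_dual \<Gamma> v)) \<in> S_dom \<Gamma>" "C \<inter> I = {}"
  shows "rational_on \<Gamma> C"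
  unfolding rational_on_def
proof (intro ballI impI)
  fix l assume l: "l \<in> L_pos \<Gamma>" "{v. l v \<noteq> 0} \<subseteq> C"
  have "(\<Sum>v\<in>I. scale (of_int (n v)) (curve_dual \<Gamma> v)) \<bullet> l = (\<Sum>v\<in>I. - of_int (n v) * l v)"
    using assms(1) finite_V
    by (subst int_form_sum_left) (auto simp: int_form_linear curve_dual_int_form finite_subset intro!: sum.cong)
  also have "\<dots> = 0"
    using assms(3) l(2) by (intro sum.neutral) auto
  finally show "chi \<Gamma> l \<ge> 1"
    using assms(2) l by (auto simp: S_dom_iff L_pos_def chi_ge_1_iff)
qed

lemma infinite_nondominant:
  assumes u: "u \<in> V" and l: "l \<in> L_pos \<Gamma>" "l u = 0" "chi \<Gamma> l \<le> 0"
  shows "infinite (S' \<Gamma> - S_dom \<Gamma>)"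
proof (rule infinite_super)
  let ?f = "\<lambda>n. scale (of_nat n) (curve_dual \<Gamma> u)"
  show "range ?f \<subseteq> S' \<Gamma> - S_dom \<Gamma>"
  proof clarify
    fix n :: nat
    have "?f n \<in> S' \<Gamma>"
      using curve_dual_in[OF u] curve_dual_curve[OF u]
      by (auto simp: S'_def L_dual_def LQ_scale int_form_linear)
    moreover have "?f n \<bullet> l = 0"
      using curve_dual_int_form[OF u] l(2) by (simp add: int_form_linear)
    then have "?f n \<notin> S_dom \<Gamma>"
      using l by (fastforce simp: S_dom_iff)
    ultimately show "?f n \<in> S' \<Gamma> - S_dom \<Gamma>" by simp
  qed
  \<comment> \<open>Pairing with \<open>curve u\<close> gives \<open>-n\<close>, which recovers the
    multiple.\<close>
  have "inj ?f"
  proof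
    fix m n assume "?f m = ?f n"
    then have "?f m \<bullet> curve u = ?f n \<bullet> curve u" by simp
    then show "m = n"
      by (simp add: int_form_linear curve_dual_curve u)
  qed
  then show "infinite (range ?f)"
    by (auto dest: finite_imageD)
qed

text \<open>Half of \<open>Z_K\<close> pairs with \<open>l\<close> to
  \<open>chi \<Gamma> l + (l \<bullet> l) / 2\<close>, which is below \<open>chi \<Gamma> l\<close>
  by definiteness; the summand \<open>s\<close> contributes a nonpositive amount.\<close>

lemma half_Z_K_translate_subset:
  "S' \<Gamma> \<inter> {scale (1 / 2) (Z_K \<Gamma>) + s | s. s \<in> S_Q \<Gamma>} \<subseteq> S_dom \<Gamma>"
proof clarify
  fix s assume s: "s \<in> S_Q \<Gamma>" and x: "scale (1 / 2) (Z_K \<Gamma>) + s \<in> S' \<Gamma>"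
  have "(scale (1 / 2) (Z_K \<Gamma>) + s) \<bullet> l < chi \<Gamma> l" if "l \<in> L_pos \<Gamma>" for l
  proof -
    have "s \<bullet> l \<le> 0" "l \<bullet> l < 0"
      using that s int_form_nonpos[of s l] negative_definite[of l]
      by (auto simp: S_Q_def L_pos_def L_def)
    then show ?thesis
      by (simp add: chi_def int_form_linear int_form_sym[of l "Z_K \<Gamma>"])
  qed
  with x show "scale (1 / 2) (Z_K \<Gamma>) + s \<in> S_dom \<Gamma>"
    by (simp add: S_dom_iff S'_def)
qed

section \<open>Submodularity of \<chi> and stability under minima\<close>

text \<open>The self-intersection of \<open>curve v\<close> is multiplied by \<open>a v = 0\<close>;
  all other entries of the intersection matrix are 0 or 1.\<close>

lemma int_form_curve_nonneg:
  assumes "\<And>w. a w \<ge> 0" "a v = 0" "v \<in> V"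
  shows "a \<bullet> curve v \<ge> 0"
  using assms
  by (auto simp: int_form_sym[of a] int_form_curve_left curve_int_def intro!: sum_nonneg)

lemma int_form_disjoint_nonneg:
  assumes "\<And>v. a v \<ge> 0" "\<And>v. b v \<ge> 0" "\<And>v. a v = 0 \<or> b v = 0"
  shows "a \<bullet> b \<ge> 0"
  using assms int_form_curve_nonneg[of a]
  by (subst int_form_expand, intro sum_nonneg) (metis mult_nonneg_nonneg mult_zero_left order_refl)

text \<open>Over the minimum \<open>w\<close>, the two elements are \<open>w + a\<close> and
  \<open>w + b\<close> and the maximum is \<open>w + a + b\<close>. The gap between the two sides is
  exactly \<open>a \<bullet> b\<close>, where \<open>a\<close> and \<open>b\<close> have disjoint
  supports.\<close>

lemma chi_submodular:
  "chi \<Gamma> (\<lambda>v. min (x v) (y v)) + chi \<Gamma> (\<lambda>v. max (x v) (y v)) \<le> chi \<Gamma> x + chi \<Gamma> y"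
proof -
  define w where "w = (\<lambda>v. min (x v) (y v))"
  define a where "a = x - w"
  define b where "b = y - w"
  have "x = w + a" "y = w + b" "(\<lambda>v. max (x v) (y v)) = w + (a + b)"
    by (auto simp: a_def b_def w_def fun_eq_iff min_def max_def)
  moreover have "a \<bullet> b \<ge> 0"
    by (rule int_form_disjoint_nonneg) (auto simp: a_def b_def w_def min_def)
  ultimately show ?thesis
    unfolding w_def[symmetric] by (simp add: chi_add int_form_linear)
qed

text \<open>The maximum of \<open>z\<close> and \<open>x\<close> is \<open>x + l\<close> with
  \<open>l\<close> effective. Dominance makes its \<chi> exceed that of \<open>x\<close> when
  \<open>l\<close> is nonzero, and submodularity passes the gain on to \<open>z\<close> over the
  minimum.\<close>

lemma chi_min_dominant:
  assumes "x \<in> S_dom \<Gamma>" "z - x \<in> L \<Gamma>"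
  shows "chi \<Gamma> (\<lambda>v. min (z v) (x v)) \<le> chi \<Gamma> z"
    and "\<not> z \<le> x \<Longrightarrow> chi \<Gamma> (\<lambda>v. min (z v) (x v)) < chi \<Gamma> z"
proof -
  let ?M = "\<lambda>v. max (z v) (x v)"
  define l where "l = z - (\<lambda>v. min (z v) (x v))"
  have M: "?M = x + l"
    by (auto simp: l_def fun_eq_iff min_def max_def)
  have l: "l \<in> L_pos \<Gamma>" if not_le: "\<not> z \<le> x"
  proof -
    have "l \<in> L \<Gamma>" unfolding l_def by (rule min_in_L) fact
    moreover have "l v \<ge> 0" for v
      by (simp add: l_def)
    moreover obtain v where "x v < z v"
      using not_le by (auto simp: le_fun_def linorder_not_le)
    then have "l v \<noteq> 0" by (simp add: l_def)
    then have "l \<noteq> 0" by auto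
    ultimately show ?thesis by (simp add: L_pos_def)
  qed
  show *: "chi \<Gamma> (\<lambda>v. min (z v) (x v)) < chi \<Gamma> z" if "\<not> z \<le> x"
  proof -
    have "chi \<Gamma> x < chi \<Gamma> ?M"
      using assms(1) l[OF that] by (simp add: S_dom_def M)
    with chi_submodular[of z x] show ?thesis by simp
  qed
  show "chi \<Gamma> (\<lambda>v. min (z v) (x v)) \<le> chi \<Gamma> z"
  proof (cases "z \<le> x")
    case True
    then have "(\<lambda>v. min (z v) (x v)) = z"
      by (auto simp: le_fun_def min_def)
    then show ?thesis by simp
  qed (use * in auto)
qed

lemma min_in_L_dual:
  assumes "x \<in> L_dual \<Gamma>" "x - y \<in> L \<Gamma>"
  shows "(\<lambda>v. min (x v) (y v)) \<in> L_dual \<Gamma>"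
proof -
  let ?a = "x - (\<lambda>v. min (x v) (y v))"
  have a: "?a \<in> L \<Gamma>" using assms(2) by (rule min_in_L)
  then have "?a \<bullet> curve v \<in> \<int>" if "v \<in> V" for v
    using that by (auto simp: int_form_sym[of ?a] int_form_curve_left L_def intro!: Ints_mult Ints_sum)
  then have "?a \<in> L_dual \<Gamma>"
    using a by (simp add: L_dual_iff L_def)
  then have "x - ?a \<in> L_dual \<Gamma>"
    by (rule L_dual_diff[OF assms(1)])
  moreover have "x - ?a = (\<lambda>v. min (x v) (y v))"
    by (simp add: fun_eq_iff)
  ultimately show ?thesis by (simp only:)
qed

text \<open>At each vertex the minimum agrees with one of the two elements. Their difference is then
  effective without \<open>curve v\<close>, so it meets that curve nonnegatively.\<close>

lemma min_stable_S': "min_stable \<Gamma> (S' \<Gamma>)"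
  unfolding min_stable_def
proof (intro ballI impI)
  fix x y assume x: "x \<in> S' \<Gamma>" and y: "y \<in> S' \<Gamma>" and d: "x - y \<in> L \<Gamma>"
  define m where "m = (\<lambda>v. min (x v) (y v))"
  have "m \<bullet> curve v \<le> 0" if v: "v \<in> V" for v
  proof -
    have *: "m \<bullet> curve v \<le> 0" if "t \<in> S' \<Gamma>" "m \<le> t" "m v = t v" for t
    proof -
      have "(t - m) \<bullet> curve v \<ge> 0"
        by (rule int_form_curve_nonneg) (use that v in \<open>auto simp: le_fun_def\<close>)
      moreover have "t \<bullet> curve v \<le> 0"
        using that v by (simp add: S'_def)
      ultimately show ?thesis by (simp add: int_form_linear)
    qed
    show ?thesis
      using *[OF x] *[OF y] by (cases "x v \<le> y v") (auto simp: m_def le_fun_def)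
  qed
  moreover have "m \<in> L_dual \<Gamma>"
    unfolding m_def using x d by (intro min_in_L_dual) (auto simp: S'_def)
  ultimately show "(\<lambda>v. min (x v) (y v)) \<in> S' \<Gamma>"
    by (simp add: S'_def flip: m_def)
qed

lemma min_stable_S_dom: "min_stable \<Gamma> (S_dom \<Gamma>)"
  unfolding min_stable_def
proof (intro ballI impI)
  fix x y assume x: "x \<in> S_dom \<Gamma>" and y: "y \<in> S_dom \<Gamma>" and d: "x - y \<in> L \<Gamma>"
  define m where "m = (\<lambda>v. min (x v) (y v))"
  have xm: "x - m \<in> L \<Gamma>"
    unfolding m_def using d by (rule min_in_L)
  have "chi \<Gamma> m < chi \<Gamma> (m + l)" if l: "l \<in> L_pos \<Gamma>" for l
  proof -
    define z where "z = m + l"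
    define z1 where "z1 = (\<lambda>v. min (z v) (x v))"
    have l': "l \<in> L \<Gamma>" "\<And>v. l v \<ge> 0" "l \<noteq> 0"
      using l by (auto simp: L_pos_def)
    have zx: "z - x \<in> L \<Gamma>"
      using L_diff[OF l'(1) xm] by (simp add: z_def algebra_simps)
    have zz1: "z - z1 \<in> L \<Gamma>"
      unfolding z1_def using zx by (rule min_in_L)
    have z1y: "z1 - y \<in> L \<Gamma>"
      using L_diff[OF L_diff[OF zx zz1] L_minus[OF d]] by (simp add: algebra_simps)
    \<comment> \<open>Since \<open>l\<close> is effective, cutting \<open>m + l\<close> down by both
      \<open>x\<close> and \<open>y\<close> returns exactly \<open>m\<close>.\<close>
    have m: "(\<lambda>v. min (z1 v) (y v)) = m"
    proof
      fix v
      show "min (z1 v) (y v) = m v"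
        using l'(2)[of v] by (auto simp: z1_def z_def m_def min_def)
    qed
    \<comment> \<open>At least one of the two cuts is strict: otherwise \<open>z\<close> lies below
      both \<open>x\<close> and \<open>y\<close>, hence below \<open>m\<close>, which forces
      \<open>l = 0\<close>.\<close>
    have "\<not> z \<le> x \<or> \<not> z1 \<le> y"
    proof (rule ccontr)
      assume "\<not> ?thesis"
      then have "z v \<le> x v" "z1 v \<le> y v" for v
        by (auto simp: le_fun_def)
      then have "z v \<le> m v" for v
        by (force simp: z1_def m_def min_def le_fun_def)
      then have "l v = 0" for v
        using l'(2)[of v] by (force simp: z_def intro: antisym)
      with l'(3) show False by auto
    qed
    then show ?thesis
      using chi_min_dominant[OF x zx] chi_min_dominant[OF y z1y]
      unfolding m z1_def[symmetric] z_def[symmetric] by linarith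
  qed
  moreover have "m \<in> L_dual \<Gamma>"
    unfolding m_def using x d by (intro min_in_L_dual) (auto simp: S_dom_def)
  ultimately show "(\<lambda>v. min (x v) (y v)) \<in> S_dom \<Gamma>"
    by (simp add: S_dom_def flip: m_def)
qed

end

section \<open>A star graph with infinitely many nondominant elements of \<open>S'\<close>\<close>

text \<open>A star whose central curve has self-intersection \<open>-2\<close> and valency 5. Already for the sub-star
  with four legs, \<open>l = 2E\<^sub>0 + E\<^sub>1 + \<dots> + E\<^sub>4\<close> has \<open>\<chi>(l) = 0\<close>, and \<open>l\<close> avoids \<open>E\<^sub>5\<close>.\<close>

definition star_graph :: "nat res_graph" where
  "star_graph = \<lparr>verts = {0..5}, edges = {0} \<times> {1..5} \<union> {1..5} \<times> {0},
     selfint = (\<lambda>v. if v = 0 then -2 else -10)\<rparr>"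

lemma star_verts: "verts star_graph = {0, 1, 2, 3, 4, 5}"
  by (auto simp: star_graph_def)

lemma star_int_form:
  "int_form star_graph x x =
     - 2 * (x 0)\<^sup>2 - 10 * ((x 1)\<^sup>2 + (x 2)\<^sup>2 + (x 3)\<^sup>2 + (x 4)\<^sup>2 + (x 5)\<^sup>2)
     + 2 * x 0 * (x 1 + x 2 + x 3 + x 4 + x 5)"
  unfolding int_form_def star_verts
  by (simp add: curve_int_def star_graph_def power2_eq_square algebra_simps)

lemma star_is_tree: "is_tree (verts star_graph) (edges star_graph)"
proof -
  have "\<not> is_cycle (edges star_graph) p" for p
  proof
    assume "is_cycle (edges star_graph) p"
    then have len: "length p \<ge> 3" and dist: "distinct p"
      and step: "\<And>i. Suc i < length p \<Longrightarrow> (p ! i, p ! Suc i) \<in> edges star_graph"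
      and wrap: "(last p, hd p) \<in> edges star_graph"
      by (auto simp: is_cycle_def)
    have ne: "p \<noteq> []" using len by auto
    \<comment> \<open>Every edge has exactly one end at the centre. Along a cycle the centre would
      recur every second step, so either entries 0 and 2 or entry 1 and the last one would both be
      the centre, against distinctness.\<close>
    have one_zero: "(a = 0) \<noteq> (b = 0)" if "(a, b) \<in> edges star_graph" for a b
      using that by (auto simp: star_graph_def)
    have "p ! 0 \<noteq> p ! 2" "p ! 1 \<noteq> p ! (length p - 1)"
      using dist len ne by (auto simp: nth_eq_iff_index_eq)
    moreover have "(p ! 0 = 0) \<noteq> (p ! 1 = 0)" "(p ! 1 = 0) \<noteq> (p ! 2 = 0)"
      using one_zero[OF step[of 0]] one_zero[OF step[of 1]] len by (auto simp: numeral_2_eq_2)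
    moreover have "(p ! (length p - 1) = 0) \<noteq> (p ! 0 = 0)"
      using one_zero[OF wrap] ne by (simp add: last_conv_nth hd_conv_nth)
    ultimately show False by metis
  qed
  moreover have "(u, v) \<in> (edges star_graph)\<^sup>*" if "u \<in> {0..5}" "v \<in> {0..5}" for u v
  proof -
    have "(u, 0) \<in> (edges star_graph)\<^sup>*"
      using that by (cases "u = 0") (auto simp: star_graph_def)
    moreover have "(0, v) \<in> (edges star_graph)\<^sup>*"
      using that by (cases "v = 0") (auto simp: star_graph_def)
    ultimately show ?thesis by (rule rtrancl_trans)
  qed
  ultimately show ?thesis
    by (auto simp: is_tree_def star_graph_def sym_def irrefl_def)
qed

lemma star_resolution_graph: "resolution_graph star_graph"
  unfolding resolution_graph_def
proof (intro conjI ballI impI star_is_tree)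
  fix x assume x: "x \<in> L star_graph" "x \<noteq> 0"
  \<comment> \<open>Completing the square at each of the five leaves costs
    \<open>(x 0)\<^sup>2 / 10\<close> per leaf, which leaves \<open>2 - 5 / 10 = 3 / 2\<close> at
    the centre.\<close>
  have eq: "int_form star_graph x x = - (3 / 2 * (x 0)\<^sup>2 + (\<Sum>i\<in>{1,2,3,4,5}. 10 * (x i - x 0 / 10)\<^sup>2))"
    by (simp add: star_int_form power2_eq_square field_simps)
  have nonneg: "(\<Sum>i\<in>{1,2,3,4,5}. 10 * (x i - x 0 / 10)\<^sup>2) \<ge> 0"
    by (intro sum_nonneg) auto
  show "int_form star_graph x x < 0"
  proof (cases "x 0 = 0")
    case False
    then have "(x 0)\<^sup>2 > 0" by simp
    with eq nonneg show ?thesis by linarith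
  next
    case True
    obtain i where i: "x i \<noteq> 0" using x(2) by (auto simp: fun_eq_iff)
    then have "i \<in> {0, 1, 2, 3, 4, 5}"
      using x(1) star_verts by (auto simp: L_def LQ_def)
    then have "i \<in> {1, 2, 3, 4, 5}" using i True by auto
    then have "(\<Sum>i\<in>{1,2,3,4,5}. 10 * (x i - x 0 / 10)\<^sup>2) > 0"
      using i True by (intro sum_pos2[of _ i]) auto
    with eq True show ?thesis by simp
  qed
qed

lemma star_infinite_nondominant: "infinite (S' star_graph - S_dom star_graph)"
proof -
  interpret resolution star_graph
    by unfold_locales (rule star_resolution_graph)
  define l :: "nat \<Rightarrow> rat" where "l = (\<lambda>v. if v = 0 then 2 else if v \<le> 4 then 1 else 0)"
  have "l \<in> L_pos star_graph"
    by (auto simp: L_pos_def L_def LQ_def l_def star_verts fun_eq_iff)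
  \<comment> \<open>The centre contributes 0 and the four leaves -8 each to the linear term, giving
    -32; the self-intersection is \<open>-8 - 40 + 16 = -32\<close> too, so they cancel.\<close>
  moreover have "chi star_graph l = 0"
    unfolding chi_eq star_int_form unfolding star_verts by (simp add: l_def star_graph_def)
  moreover have "l 5 = 0" by (simp add: l_def)
  ultimately show ?thesis
    by (intro infinite_nondominant[of 5 l]) (simp_all add: star_verts)
qed

theorem lemma4p1p7:
  fixes \<Gamma> :: "'v res_graph"
  assumes "resolution_graph \<Gamma>"
  shows
    "S_dom \<Gamma> = {l' \<in> L_dual \<Gamma>. \<forall>l\<in>L_pos \<Gamma>. chi \<Gamma> l > int_form \<Gamma> l' l} \<and>
     (\<comment> \<open>(i)\<close>
      S_dom \<Gamma> \<subseteq> S' \<Gamma>) \<and>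
     (\<comment> \<open>(ii)\<close>
      (0 \<in> S_dom \<Gamma> \<longleftrightarrow> rational_graph \<Gamma>) \<and>
      (\<forall>I (n :: 'v \<Rightarrow> int).
         I \<subseteq> verts \<Gamma> \<and> (\<forall>v\<in>I. n v > 0) \<and>
         (\<Sum>v\<in>I. scale (of_int (n v)) (curve_dual \<Gamma> v)) \<in> S_dom \<Gamma> \<longrightarrow>
         (\<forall>C\<in>graph_components \<Gamma> (verts \<Gamma> - I). rational_on \<Gamma> C)) \<and>
      (\<forall>I. I \<subseteq> verts \<Gamma> \<and> I \<noteq> {} \<and>
           (\<exists>C\<in>graph_components \<Gamma> (verts \<Gamma> - I). \<not> rational_on \<Gamma> C) \<longrightarrow>
           infinite (S' \<Gamma> - S_dom \<Gamma>)) \<and>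
      (\<exists>\<Delta> :: nat res_graph. resolution_graph \<Delta> \<and> infinite (S' \<Delta> - S_dom \<Delta>))) \<and>
     (\<comment> \<open>(iii)\<close>
      S' \<Gamma> \<inter> {scale (1 / 2) (Z_K \<Gamma>) + s | s. s \<in> S_Q \<Gamma>} \<subseteq> S_dom \<Gamma>) \<and>
     (\<comment> \<open>(iv)\<close>
      \<forall>l1\<in>S_dom \<Gamma>. \<forall>l2\<in>S_dom \<Gamma>. l1 + l2 \<in> S_dom \<Gamma>) \<and>
     (\<comment> \<open>(v)\<close>
      \<forall>l1\<in>S_dom \<Gamma>. \<forall>l2\<in>S' \<Gamma>. l1 + l2 \<in> S_dom \<Gamma>) \<and>
     (\<comment> \<open>(vi)\<close>
      min_stable \<Gamma> (S' \<Gamma>) \<and> min_stable \<Gamma> (S_dom \<Gamma>))"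
proof -
  interpret resolution \<Gamma>
    by unfold_locales fact
  have dominant: "S_dom \<Gamma> = {l' \<in> L_dual \<Gamma>. \<forall>l\<in>L_pos \<Gamma>. chi \<Gamma> l > int_form \<Gamma> l' l}"
    by (auto simp: S_dom_iff)
  \<comment> \<open>A cycle violating Artin's criterion on a component of the complement of
    \<open>I\<close> avoids every \<open>u\<close> in \<open>I\<close>, so the multiples of a single
    \<open>curve_dual \<Gamma> u\<close> suffice.\<close>
  have infinite: "infinite (S' \<Gamma> - S_dom \<Gamma>)"
    if I: "I \<subseteq> verts \<Gamma>" "I \<noteq> {}" and C: "C \<in> graph_components \<Gamma> (verts \<Gamma> - I)" "\<not> rational_on \<Gamma> C"
    for I C
  proof -
    obtain u where u: "u \<in> I" using I by auto
    obtain l where l: "l \<in> L_pos \<Gamma>" "{v. l v \<noteq> 0} \<subseteq> C" "\<not> chi \<Gamma> l \<ge> 1"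
      using C by (auto simp: rational_on_def)
    have "chi \<Gamma> l \<le> 0"
      using l chi_ge_1_iff[of l] by (auto simp: L_pos_def)
    then show ?thesis
      using infinite_nondominant[of u l] u I l graph_components_subset[OF C(1)] by auto
  qed
  have rational: "rational_on \<Gamma> C"
    if "I \<subseteq> verts \<Gamma>" "(\<Sum>v\<in>I. scale (of_int (n v)) (curve_dual \<Gamma> v)) \<in> S_dom \<Gamma>"
      "C \<in> graph_components \<Gamma> (verts \<Gamma> - I)" for I C and n :: "'v \<Rightarrow> int"
    using that graph_components_subset[OF that(3)] by (intro rational_on_if_dominant) auto
  show ?thesis
  proof (intro conjI)
    show "\<exists>\<Delta> :: nat res_graph. resolution_graph \<Delta> \<and> infinite (S' \<Delta> - S_dom \<Delta>)"
      using star_resolution_graph star_infinite_nondominant by blast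
    show "\<forall>l1\<in>S_dom \<Gamma>. \<forall>l2\<in>S_dom \<Gamma>. l1 + l2 \<in> S_dom \<Gamma>"
      using S_dom_add S_dom_subset by blast
    show "\<forall>l1\<in>S_dom \<Gamma>. \<forall>l2\<in>S' \<Gamma>. l1 + l2 \<in> S_dom \<Gamma>"
      using S_dom_add by blast
    show "\<forall>I (n :: 'v \<Rightarrow> int).
        I \<subseteq> verts \<Gamma> \<and> (\<forall>v\<in>I. n v > 0) \<and>
        (\<Sum>v\<in>I. scale (of_int (n v)) (curve_dual \<Gamma> v)) \<in> S_dom \<Gamma> \<longrightarrow>
        (\<forall>C\<in>graph_components \<Gamma> (verts \<Gamma> - I). rational_on \<Gamma> C)"
      by (intro allI impI ballI, elim conjE) (rule rational)
    show "\<forall>I. I \<subseteq> verts \<Gamma> \<and> I \<noteq> {} \<and>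
        (\<exists>C\<in>graph_components \<Gamma> (verts \<Gamma> - I). \<not> rational_on \<Gamma> C) \<longrightarrow>
        infinite (S' \<Gamma> - S_dom \<Gamma>)"
      using infinite by blast
  qed (rule dominant S_dom_subset zero_in_S_dom_iff half_Z_K_translate_subset
      min_stable_S' min_stable_S_dom)+
qed

end
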